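(* Let $k\ge1$ and let $f_1,f_2,\ldots,f_k$ be transcendental entire functions. Suppose that there is a family of functions $(\psi_m)_{m>1}$ such that, for all $j\in\{1,2,\ldots,k\}$, $f_j$ is $\psi$-regular with regularity function $\psi_m$ for every $m>1$. Let $g=f_1\circ f_2\circ\cdots\circ f_k$. Then, for any $c>1$, $g$ is $\psi$-regular with regularity function $c\,\psi_m$ for every $m>1$.
   Context: For an entire function $f$ put $M(r,f)=\max_{|z|=r}|f(z)|$ for $r>0$. A transcendental entire function $f$ is $\psi$-regular if for each $m>1$ there exist an increasing function $\psi_m$ (real-valued, defined for all sufficiently large $r$) and $R_m>0$ such that, for all $r\ge R_m$, $\psi_m(r)\ge r$ and $M(\psi_m(r),f)\ge(\psi_m(M(r,f)))^m$. For given $m$, $\psi_m$ is then called a regularity function for $f$. (The threshold $R_m$ may depend on the function $f$.) *)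

theory Defs
  imports "HOL-Complex_Analysis.Complex_Analysis" "HOL-Computational_Algebra.Polynomial"
begin

definition transcendental_entire :: "(complex \<Rightarrow> complex) \<Rightarrow> bool" where
  "transcendental_entire f \<longleftrightarrow> f holomorphic_on UNIV \<and> (\<nexists>p. f = poly p)"

(* The maximum modulus M(r,f), meaningful for r >= 0; the supremum is attained
   for entire f, see max_modulus_attained. *)
definition max_modulus :: "real \<Rightarrow> (complex \<Rightarrow> complex) \<Rightarrow> real" where
  "max_modulus r f = (SUP z\<in>sphere 0 r. norm (f z))"

lemma max_modulus_attained:
  assumes "f holomorphic_on UNIV" and "r \<ge> 0"
  obtains z where "norm z = r" and "norm (f z) = max_modulus r f"
    and "\<And>w. norm w = r \<Longrightarrow> norm (f w) \<le> max_modulus r f"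
proof -
  have "continuous_on (sphere 0 r) (\<lambda>z. norm (f z))"
    using assms(1) by (intro continuous_on_norm holomorphic_on_imp_continuous_on)
      (rule holomorphic_on_subset, auto)
  moreover have "sphere (0::complex) r \<noteq> {}"
    using assms(2) by simp
  ultimately obtain z where z: "z \<in> sphere 0 r"
      "\<And>w. w \<in> sphere 0 r \<Longrightarrow> norm (f w) \<le> norm (f z)"
    using continuous_attains_sup[of "sphere (0::complex) r" "\<lambda>z. norm (f z)"] by auto
  have "max_modulus r f = norm (f z)"
    unfolding max_modulus_def using z by (intro cSup_eq_maximum) auto
  then show ?thesis
    using that[of z] z by auto
qed

(* "h is a regularity function for f, for the exponent m".  The function h is only
   meaningful on a half-line {a..}, on which it is increasing (in the sense of
   nondecreasing); the conditions a <= r and a <= M(r,f) say that h is evaluated on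
   that half-line only.  The threshold R depends on m and on f. *)
definition regularity_function ::
  "real \<Rightarrow> (real \<Rightarrow> real) \<Rightarrow> (complex \<Rightarrow> complex) \<Rightarrow> bool" where
  "regularity_function m h f \<longleftrightarrow>
     (\<exists>a. mono_on {a..} h \<and>
       (\<exists>R>0. \<forall>r\<ge>R. a \<le> r \<and> a \<le> max_modulus r f \<and>
          h r \<ge> r \<and>
          max_modulus (h r) f \<ge> (h (max_modulus r f)) powr m))"

definition psi_regular :: "(complex \<Rightarrow> complex) \<Rightarrow> bool" where
  "psi_regular f \<longleftrightarrow>
     transcendental_entire f \<and> (\<forall>m>1. \<exists>h. regularity_function m h f)"

end

(* With Schottky's theorem, the image under a transcendental entire h of the disc of radius
   c r contains, for c > 1 and large r, a circle of radius at least M(r, h). Hence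
   M(M(r, h), f) <= M(c r, f o h), which complements the trivial bound
   M(r, f o h) <= M(M(r, h), f). Moreover M(c r, f) / M(r, f) tends to infinity, so the factor
   c in c psi_m absorbs all constants: the regularity inequality survives in the
   form M(c psi(r), g) >= (C psi(M(r, g)))^m for all c > 1 and C > 0, and in this form it passes
   from f and h to f o h, with sqrt c spent on each factor. *)

theory Submission
  imports Defs
begin

section \<open>The maximum modulus of entire functions\<close>

lemma entire_holomorphic_on: "f holomorphic_on UNIV \<Longrightarrow> f holomorphic_on S"
  by (rule holomorphic_on_subset) auto

lemma entire_continuous_on: "f holomorphic_on UNIV \<Longrightarrow> continuous_on S f"
  for f :: "complex \<Rightarrow> complex"
  by (rule holomorphic_on_imp_continuous_on[OF entire_holomorphic_on])

text \<open>By the maximum modulus principle, the bound that defines \<open>max_modulus r f\<close>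
  on the circle extends to the disc; monotonicity in the radius follows.\<close>

lemma norm_le_max_modulus:
  assumes f: "f holomorphic_on UNIV" and z: "norm z \<le> r"
  shows "norm (f z) \<le> max_modulus r f"
proof -
  have r: "0 \<le> r" using z norm_ge_zero[of z] by linarith
  obtain w where w: "\<And>x. norm x = r \<Longrightarrow> norm (f x) \<le> max_modulus r f"
    using max_modulus_attained[OF f r] by blast
  show ?thesis
  proof (rule maximum_modulus_frontier[of f "cball 0 r"])
    show "f holomorphic_on interior (cball 0 r)" by (rule entire_holomorphic_on[OF f])
    show "continuous_on (closure (cball 0 r)) f" by (rule entire_continuous_on[OF f])
    show "norm (f x) \<le> max_modulus r f" if "x \<in> frontier (cball 0 r)" for x
      using that w[of x] by simp
  qed (use z in auto)
qed

lemma max_modulus_least: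
  assumes f: "f holomorphic_on UNIV" and "0 \<le> r"
    and "\<And>z. norm z = r \<Longrightarrow> norm (f z) \<le> B"
  shows "max_modulus r f \<le> B"
  using max_modulus_attained[OF f \<open>0 \<le> r\<close>] assms(3) by metis

lemma max_modulus_mono:
  assumes f: "f holomorphic_on UNIV" and "0 \<le> r" "r \<le> s"
  shows "max_modulus r f \<le> max_modulus s f"
  by (rule max_modulus_least[OF f \<open>0 \<le> r\<close>]) (use assms in \<open>auto intro: norm_le_max_modulus\<close>)

lemma max_modulus_nonneg:
  assumes f: "f holomorphic_on UNIV" and "0 \<le> r"
  shows "0 \<le> max_modulus r f"
  using norm_le_max_modulus[OF f, of 0 r] assms(2) norm_ge_zero[of "f 0"] by (simp del: norm_ge_zero)

lemma max_modulus_compose_le: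
  assumes f: "f holomorphic_on UNIV" and h: "h holomorphic_on UNIV" and "0 \<le> r"
  shows "max_modulus r (f \<circ> h) \<le> max_modulus (max_modulus r h) f"
proof (rule max_modulus_least)
  show "f \<circ> h holomorphic_on UNIV"
    using holomorphic_on_compose[OF h] entire_holomorphic_on[OF f] by blast
  show "norm ((f \<circ> h) z) \<le> max_modulus (max_modulus r h) f" if "norm z = r" for z
    using that by (auto intro!: norm_le_max_modulus f h)
qed fact

section \<open>Growth of transcendental entire functions\<close>

lemma transcendental_entire_holomorphic:
  "transcendental_entire f \<Longrightarrow> f holomorphic_on UNIV"
  by (simp add: transcendental_entire_def)

text \<open>Otherwise the Taylor series at 0 would stop at degree \<open>n\<close>, and
  \<open>f\<close> would be a polynomial.\<close>

lemma transcendental_entire_deriv_nonzero: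
  assumes "transcendental_entire f"
  obtains k where "n < k" and "(deriv ^^ k) f 0 \<noteq> 0"
proof (rule ccontr)
  assume "\<not> thesis"
  with that have zero: "(deriv ^^ k) f 0 = 0" if "n < k" for k using \<open>n < k\<close> by blast
  define p where "p = (\<Sum>k\<le>n. monom ((deriv ^^ k) f 0 / fact k) k)"
  have "f z = poly p z" for z
  proof -
    have "(\<lambda>k. (deriv ^^ k) f 0 / fact k * (z - 0) ^ k) sums f z"
      by (rule holomorphic_power_series[of f 0 "norm z + 1"])
        (use assms in \<open>auto simp: transcendental_entire_def intro: entire_holomorphic_on\<close>)
    moreover have "(\<lambda>k. (deriv ^^ k) f 0 / fact k * (z - 0) ^ k) sums
        (\<Sum>k\<le>n. (deriv ^^ k) f 0 / fact k * (z - 0) ^ k)"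
      by (rule sums_finite) (auto simp: zero)
    ultimately have "f z = (\<Sum>k\<le>n. (deriv ^^ k) f 0 / fact k * (z - 0) ^ k)"
      by (rule sums_unique2)
    then show ?thesis by (simp add: p_def poly_sum poly_monom)
  qed
  with assms show False by (auto simp: transcendental_entire_def)
qed

text \<open>Cauchy's inequality for one nonvanishing Taylor coefficient of index
  \<open>k > n\<close> gives growth of order at least \<open>r ^ k\<close>; the surplus factor
  \<open>r\<close> outgrows the constant \<open>C\<close>.\<close>

lemma max_modulus_superpolynomial:
  assumes f: "transcendental_entire f"
  shows "\<forall>\<^sub>F r in at_top. C * r ^ n \<le> max_modulus r f"
proof -
  note hol = transcendental_entire_holomorphic[OF f]
  obtain k where k: "n < k" "(deriv ^^ k) f 0 \<noteq> 0"
    using transcendental_entire_deriv_nonzero[OF f] .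
  define A where "A = norm ((deriv ^^ k) f 0) / fact k"
  have A: "A > 0" using k by (simp add: A_def)
  show ?thesis
    using eventually_ge_at_top[of "max 1 (C / A)"]
  proof eventually_elim
    case (elim r)
    then have r: "r \<ge> 1" and "C \<le> r * A" using A by (auto simp: pos_divide_le_eq)
    have "norm ((deriv ^^ k) f 0) \<le> fact k * max_modulus r f / r ^ k"
      using r by (intro Cauchy_inequality entire_holomorphic_on[OF hol]
          entire_continuous_on[OF hol] norm_le_max_modulus[OF hol]) auto
    then have *: "A * r ^ k \<le> max_modulus r f"
      using r by (simp add: A_def field_simps)
    have "C * r ^ n \<le> (r * A) * r ^ n"
      using \<open>C \<le> r * A\<close> r by (intro mult_right_mono) auto
    also have "\<dots> = A * r ^ Suc n" by simp
    also have "\<dots> \<le> A * r ^ k"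
      using k A r by (intro mult_left_mono power_increasing) auto
    finally show ?case using * by linarith
  qed
qed

lemma filterlim_max_modulus:
  assumes "transcendental_entire f"
  shows "filterlim (\<lambda>r. max_modulus r f) at_top at_top"
  using max_modulus_superpolynomial[OF assms, of 1 1]
  by (intro filterlim_at_top_mono[OF filterlim_ident]) simp

text \<open>Here \<open>q\<close> is \<open>f\<close> minus its Taylor polynomial of degree below
  \<open>n\<close>, divided by \<open>z ^ n\<close>. The induction splits off one coefficient at a
  time, so that only the size of the removed polynomial has to be tracked.\<close>

lemma entire_taylor_remainder:
  assumes f: "f holomorphic_on UNIV"
  shows "\<exists>q A. q holomorphic_on UNIV \<and> 0 \<le> A \<and>
    (\<forall>z. norm (f z - z ^ n * q z) \<le> A * (1 + norm z) ^ n)"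
proof (induction n)
  case 0
  show ?case by (rule exI[of _ f], rule exI[of _ 0]) (use f in auto)
next
  case (Suc n)
  then obtain q A where q: "q holomorphic_on UNIV" and A: "0 \<le> A"
    and le: "\<And>z. norm (f z - z ^ n * q z) \<le> A * (1 + norm z) ^ n" by blast
  \<comment> \<open>The difference quotient of \<open>q\<close> at 0; the derivative as value at 0
    fills the removable singularity. The coefficient split off is \<open>q 0\<close>, hence the new
    constant \<open>A + norm (q 0)\<close>.\<close>
  define u where "u z = (if z = 0 then deriv q 0 else (q z - q 0) / z)" for z
  have "u holomorphic_on UNIV"
  proof (rule pole_theorem_0)
    show "(\<lambda>z. q z - q 0) holomorphic_on UNIV" by (intro holomorphic_intros q)
    have "q field_differentiable at 0"
      using q by (simp add: holomorphic_on_def)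
    then show "u 0 = deriv (\<lambda>z. q z - q 0) 0" by (simp add: u_def)
  qed (auto simp: u_def)
  moreover have "norm (f z - z ^ Suc n * u z) \<le> (A + norm (q 0)) * (1 + norm z) ^ Suc n" for z
  proof -
    have "z * u z = q z - q 0" by (simp add: u_def)
    then have "z ^ Suc n * u z = z ^ n * (q z - q 0)" by (simp only: power_Suc2 mult.assoc)
    then have "f z - z ^ Suc n * u z = (f z - z ^ n * q z) + z ^ n * q 0"
      by (simp add: algebra_simps)
    then have "norm (f z - z ^ Suc n * u z) \<le> norm (f z - z ^ n * q z) + norm (z ^ n * q 0)"
      by (simp only: norm_triangle_ineq)
    also have "norm (z ^ n * q 0) \<le> (1 + norm z) ^ n * norm (q 0)"
      by (auto simp: norm_mult norm_power intro!: mult_right_mono power_mono)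
    also have "norm (f z - z ^ n * q z) + (1 + norm z) ^ n * norm (q 0)
        \<le> (A + norm (q 0)) * (1 + norm z) ^ n"
      using le[of z] by (simp add: algebra_simps)
    also have "\<dots> \<le> (A + norm (q 0)) * (1 + norm z) ^ Suc n"
      using A by (intro mult_left_mono power_increasing) auto
    finally show ?thesis by simp
  qed
  ultimately show ?case using A by (intro exI[of _ u] exI[of _ "A + norm (q 0)"]) auto
qed

text \<open>Write \<open>f z = z^n * q z + O(z^n)\<close>. The factor \<open>z^n\<close> alone gains \<open>c^n\<close> on
  passing from radius \<open>r\<close> to \<open>c * r\<close>, and the error is negligible.\<close>

lemma max_modulus_dilate:
  assumes f: "transcendental_entire f" and c: "c > 1"
  shows "\<forall>\<^sub>F r in at_top. K * max_modulus r f \<le> max_modulus (c * r) f"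
proof -
  note hol = transcendental_entire_holomorphic[OF f]
  \<comment> \<open>The factor 2 pays for the error terms, which will cost at most half of
    \<open>c ^ n * max_modulus r f\<close>.\<close>
  obtain n where n: "2 * K < c ^ n" using real_arch_pow[OF c] by blast
  obtain q A where q: "q holomorphic_on UNIV" and A: "0 \<le> A"
    and le: "\<And>z. norm (f z - z ^ n * q z) \<le> A * (1 + norm z) ^ n"
    using entire_taylor_remainder[OF hol] by blast
  have le': "norm (f z - z ^ n * q z) \<le> A * 2 ^ n * s ^ n" if "norm z = s" "1 \<le> s" for z s
  proof -
    have "(1 + norm z) ^ n \<le> (2 * s) ^ n" using that by (intro power_mono) auto
    then have "A * (1 + norm z) ^ n \<le> A * (2 * s) ^ n" using A by (rule mult_left_mono)
    then show ?thesis using le[of z] by (simp add: power_mult_distrib)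
  qed
  show ?thesis
    \<comment> \<open>The errors at radii \<open>r\<close> and \<open>c * r\<close> add up to
      \<open>2 * A * 2 ^ n * (c * r) ^ n\<close>; the constant 4 makes this at most half of
      \<open>c ^ n * max_modulus r f\<close>.\<close>
    using eventually_ge_at_top[of 1] max_modulus_superpolynomial[OF f, of "4 * A * 2 ^ n" n]
  proof eventually_elim
    case (elim r)
    have cr: "1 \<le> c * r" using elim(1) c by (simp add: mult_ge1_I)
    have Mr: "max_modulus r f \<le> r ^ n * max_modulus r q + A * 2 ^ n * r ^ n"
    proof (rule max_modulus_least[OF hol])
      fix z :: complex assume z: "norm z = r"
      have "norm (f z) \<le> norm (z ^ n * q z) + norm (f z - z ^ n * q z)"
        by (metis add.commute diff_add_cancel norm_triangle_ineq)
      also have "norm (z ^ n * q z) \<le> r ^ n * max_modulus r q"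
        using z elim by (auto simp: norm_mult norm_power intro!: mult_left_mono norm_le_max_modulus q)
      finally show "norm (f z) \<le> r ^ n * max_modulus r q + A * 2 ^ n * r ^ n"
        using le'[OF z] elim by linarith
    qed (use elim in auto)
    obtain w where w: "norm w = c * r" "norm (q w) = max_modulus (c * r) q"
      using max_modulus_attained[OF q, of "c * r"] cr by auto
    have "(c * r) ^ n * max_modulus (c * r) q = norm (w ^ n * q w)"
      by (simp add: w norm_mult norm_power)
    also have "\<dots> \<le> norm (f w) + norm (f w - w ^ n * q w)"
      by (metis norm_triangle_sub norm_minus_commute)
    also have "\<dots> \<le> max_modulus (c * r) f + A * 2 ^ n * (c * r) ^ n"
      using le'[OF w(1) cr] w by (intro add_mono norm_le_max_modulus hol) auto
    finally have Mcr: "(c * r) ^ n * max_modulus (c * r) q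
        \<le> max_modulus (c * r) f + A * 2 ^ n * (c * r) ^ n" .
    have "max_modulus r q \<le> max_modulus (c * r) q"
      using elim c by (intro max_modulus_mono q) auto
    then have "c ^ n * (r ^ n * max_modulus r q) \<le> (c * r) ^ n * max_modulus (c * r) q"
      using c elim by (simp add: power_mult_distrib mult_left_mono)
    moreover have "c ^ n * max_modulus r f \<le> c ^ n * (r ^ n * max_modulus r q + A * 2 ^ n * r ^ n)"
      using Mr c by (intro mult_left_mono) auto
    moreover have "c ^ n * (4 * A * 2 ^ n * r ^ n) \<le> c ^ n * max_modulus r f"
      using elim c by (intro mult_left_mono) auto
    ultimately have "c ^ n * max_modulus r f \<le> 2 * max_modulus (c * r) f"
      using Mcr by (simp add: power_mult_distrib algebra_simps)
    moreover have "2 * K * max_modulus r f \<le> c ^ n * max_modulus r f"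
      using n elim by (intro mult_right_mono max_modulus_nonneg hol) auto
    ultimately show ?case by linarith
  qed
qed

section \<open>Composition\<close>

text \<open>If the circles of radius \<open>s\<close> and \<open>2 * s\<close> both contained a value omitted by \<open>h\<close> on the
  disc, then Schottky's theorem, applied after the affine normalisation sending these two
  values to 0 and 1, would bound \<open>h\<close>.\<close>

lemma image_contains_circle:
  assumes h: "h holomorphic_on UNIV" and t: "0 < t" "t < 1" and R: "0 < R" and s: "0 < s"
    and h0: "norm (h 0) \<le> s"
    and large: "(1 + 3 * exp (pi * exp (pi * (6 + 12 * t / (1 - t))))) * s < max_modulus (t * R) h"
  obtains \<rho> where "s \<le> \<rho>" and "sphere 0 \<rho> \<subseteq> h ` cball 0 R"
proof (rule ccontr)
  assume "\<not> thesis"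
  with that have no: "\<not> sphere 0 \<rho> \<subseteq> h ` cball 0 R" if "s \<le> \<rho>" for \<rho>
    using \<open>s \<le> \<rho>\<close> by blast
  obtain a where "a \<in> sphere 0 s" and "a \<notin> h ` cball 0 R" using no[of s] by blast
  then have a: "norm a = s" "a \<notin> h ` cball 0 R" by simp_all
  have "\<not> sphere 0 (2 * s) \<subseteq> h ` cball 0 R" using no[of "2 * s"] s by simp
  then obtain b where "b \<in> sphere 0 (2 * s)" and "b \<notin> h ` cball 0 R" by blast
  then have b: "norm b = 2 * s" "b \<notin> h ` cball 0 R" by simp_all
  \<comment> \<open>Schottky's bound on the disc of radius \<open>t\<close> for a function of norm
    at most 2 at the origin: the 6 is \<open>2 + 2 * 2\<close>.\<close>
  define E where "E = exp (pi * exp (pi * (6 + 12 * t / (1 - t))))"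
  have ba: "s \<le> norm (b - a)" "norm (b - a) \<le> 3 * s"
    using norm_triangle_ineq2[of b a] norm_triangle_ineq4[of b a] a b by auto
  then have "b \<noteq> a" using s by auto
  define \<phi> where "\<phi> u = (h (of_real R * u) - a) / (b - a)" for u
  have "\<phi> holomorphic_on cball 0 1"
  proof -
    have "(\<lambda>u. h (of_real R * u)) holomorphic_on cball 0 1"
      using holomorphic_on_compose[of "\<lambda>u. of_real R * u" "cball 0 1" h]
        entire_holomorphic_on[OF h]
      by (simp add: o_def holomorphic_on_mult holomorphic_on_const holomorphic_on_ident)
    then show ?thesis
      unfolding \<phi>_def using \<open>b \<noteq> a\<close>
      by (intro holomorphic_on_divide holomorphic_on_diff holomorphic_on_const) auto
  qed
  moreover have "norm (\<phi> 0) \<le> 2"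
  proof -
    have "norm (h 0 - a) \<le> 2 * s"
      using norm_triangle_ineq4[of "h 0" a] h0 a by linarith
    also have "\<dots> \<le> 2 * norm (b - a)" using ba by simp
    finally show ?thesis using \<open>b \<noteq> a\<close> by (simp add: \<phi>_def norm_divide divide_le_eq)
  qed
  moreover have "\<not> (\<phi> u = 0 \<or> \<phi> u = 1)" if "u \<in> cball 0 1" for u
  proof -
    have "of_real R * u \<in> cball 0 R" using that R by (simp add: norm_mult)
    then have "h (of_real R * u) \<noteq> a" "h (of_real R * u) \<noteq> b" using a b by blast+
    then show ?thesis using \<open>b \<noteq> a\<close> by (simp add: \<phi>_def)
  qed
  ultimately have Sch: "norm (\<phi> u) \<le> E" if "norm u \<le> t" for u
    using Schottky[of \<phi> 2 t u] t that by (simp add: E_def)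
  have "max_modulus (t * R) h \<le> (1 + 3 * E) * s"
  proof (rule max_modulus_least[OF h])
    fix z :: complex assume z: "norm z = t * R"
    define u where "u = z / of_real R"
    have "norm u \<le> t" using z R by (simp add: u_def norm_divide)
    have hz: "h z = a + (b - a) * \<phi> u"
      using R \<open>b \<noteq> a\<close> by (simp add: \<phi>_def u_def)
    have "norm (h z) \<le> norm a + norm (b - a) * norm (\<phi> u)"
      unfolding hz by (metis norm_mult norm_triangle_ineq)
    also have "\<dots> \<le> s + 3 * s * E"
      using a ba s Sch[OF \<open>norm u \<le> t\<close>] by (intro add_mono mult_mono) auto
    finally show "norm (h z) \<le> (1 + 3 * E) * s" by (simp add: algebra_simps)
  qed (use t R in auto)
  with large show False by (simp add: E_def)
qed

text \<open>A circle of radius at least \<open>max_modulus r h\<close> lies in the image under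
  \<open>h\<close> of the disc of radius \<open>c * r\<close>, and every value of \<open>f\<close>
  on that circle is a value of \<open>f \<circ> h\<close> on the disc.\<close>

lemma max_modulus_compose_ge:
  assumes f: "f holomorphic_on UNIV" and h: "transcendental_entire h" and c: "c > 1"
  shows "\<forall>\<^sub>F r in at_top. max_modulus (max_modulus r h) f \<le> max_modulus (c * r) (f \<circ> h)"
proof -
  note hh = transcendental_entire_holomorphic[OF h]
  \<comment> \<open>The dilation is split in two: passing from \<open>r\<close> to
    \<open>sqrt c * r\<close> makes \<open>max_modulus\<close> of \<open>h\<close> exceed Schottky's
    constant times its value at \<open>r\<close>, and the remaining \<open>sqrt c\<close> leaves
    room between \<open>t * (c * r)\<close> and \<open>c * r\<close> for Schottky's theorem.\<close>
  define t where "t = 1 / sqrt c"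
  have d: "sqrt c > 1" "sqrt c * sqrt c = c" using c by simp_all
  have t: "0 < t" "t < 1" using d by (auto simp: t_def)
  have tc: "t * (c * r) = sqrt c * r" for r
    using d by (simp add: t_def field_simps)
  define K where "K = 1 + 3 * exp (pi * exp (pi * (6 + 12 * t / (1 - t))))"
  have comp: "f \<circ> h holomorphic_on UNIV"
    using holomorphic_on_compose[OF hh] entire_holomorphic_on[OF f] by blast
  show ?thesis
    \<comment> \<open>Since \<open>max_modulus r h\<close> is positive, \<open>K + 1\<close> in
      place of \<open>K\<close> yields the strict inequality that
      \<open>image_contains_circle\<close> demands.\<close>
    using eventually_gt_at_top[of 0] max_modulus_dilate[OF h d(1), of "K + 1"]
      filterlim_max_modulus[OF h, unfolded filterlim_at_top_dense, rule_format, of 0]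
  proof eventually_elim
    case (elim r)
    have R: "0 < c * r" using elim c by simp
    have "K * max_modulus r h < (K + 1) * max_modulus r h" using elim by (simp add: algebra_simps)
    also have "\<dots> \<le> max_modulus (t * (c * r)) h" using elim by (simp add: tc)
    finally have "K * max_modulus r h < max_modulus (t * (c * r)) h" .
    moreover have "norm (h 0) \<le> max_modulus r h"
      using elim by (intro norm_le_max_modulus hh) auto
    ultimately obtain \<rho> where \<rho>: "max_modulus r h \<le> \<rho>" "sphere 0 \<rho> \<subseteq> h ` cball 0 (c * r)"
      using image_contains_circle[OF hh t R elim(3)] by (auto simp: K_def)
    have "max_modulus (max_modulus r h) f \<le> max_modulus \<rho> f"
      using elim \<rho> by (intro max_modulus_mono f) auto
    also have "\<dots> \<le> max_modulus (c * r) (f \<circ> h)"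
    proof (rule max_modulus_least[OF f])
      fix w :: complex assume "norm w = \<rho>"
      then have "w \<in> h ` cball 0 (c * r)" using \<rho> by (auto simp: subset_iff)
      then obtain z where "norm z \<le> c * r" "w = h z" by auto
      then show "norm (f w) \<le> max_modulus (c * r) (f \<circ> h)"
        using norm_le_max_modulus[OF comp] by auto
    qed (use elim \<rho> in auto)
    finally show ?case .
  qed
qed

lemma poly_norm_bound:
  fixes p :: "complex poly"
  obtains A where "\<And>z. 1 \<le> norm z \<Longrightarrow> norm (poly p z) \<le> A * norm z ^ degree p"
proof
  fix z :: complex assume z: "1 \<le> norm z"
  have "norm (poly p z) \<le> (\<Sum>i\<le>degree p. norm (coeff p i * z ^ i))"
    unfolding poly_altdef by (rule norm_sum)
  also have "\<dots> \<le> (\<Sum>i\<le>degree p. norm (coeff p i) * norm z ^ degree p)"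
    using z by (intro sum_mono) (auto simp: norm_mult norm_power intro!: mult_left_mono power_increasing)
  finally show "norm (poly p z) \<le> (\<Sum>i\<le>degree p. norm (coeff p i)) * norm z ^ degree p"
    by (simp add: sum_distrib_right)
qed

text \<open>As \<open>f\<close> eventually grows at least like the identity, the lower bound for
  composites gives \<open>max_modulus r h \<le> max_modulus (2 * r) (f \<circ> h)\<close>. Were
  \<open>f \<circ> h\<close> a polynomial, \<open>h\<close> would grow only polynomially.\<close>

lemma transcendental_entire_compose:
  assumes f: "transcendental_entire f" and h: "transcendental_entire h"
  shows "transcendental_entire (f \<circ> h)"
proof -
  note hf = transcendental_entire_holomorphic[OF f] and hh = transcendental_entire_holomorphic[OF h]
  have comp: "f \<circ> h holomorphic_on UNIV"
    using holomorphic_on_compose[OF hh] entire_holomorphic_on[OF hf] by blast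
  have False if p: "f \<circ> h = poly p" for p
  proof -
    obtain A where A: "\<And>z. 1 \<le> norm z \<Longrightarrow> norm (poly p z) \<le> A * norm z ^ degree p"
      using poly_norm_bound by blast
    \<comment> \<open>The polynomial bound at radius \<open>2 * r\<close> is
      \<open>A * 2 ^ degree p * r ^ degree p\<close>; the added 1 makes \<open>h\<close> exceed it
      strictly.\<close>
    have "\<forall>\<^sub>F r::real in at_top. 1 \<le> r \<and> max_modulus r h \<le> max_modulus (2 * r) (f \<circ> h)
        \<and> (A * 2 ^ degree p + 1) * r ^ degree p \<le> max_modulus r h"
      using eventually_ge_at_top[of 1] max_modulus_compose_ge[OF hf h, of 2, simplified]
        eventually_compose_filterlim[OF max_modulus_superpolynomial[OF f, of 1 1]
          filterlim_max_modulus[OF h]]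
        max_modulus_superpolynomial[OF h, of "A * 2 ^ degree p + 1" "degree p"]
      by eventually_elim auto
    then obtain r where r: "1 \<le> r" "max_modulus r h \<le> max_modulus (2 * r) (f \<circ> h)"
        "(A * 2 ^ degree p + 1) * r ^ degree p \<le> max_modulus r h"
      by (metis (no_types, lifting) eventually_happens trivial_limit_at_top_linorder)
    have "max_modulus (2 * r) (f \<circ> h) \<le> A * (2 * r) ^ degree p"
    proof (rule max_modulus_least[OF comp])
      show "norm ((f \<circ> h) z) \<le> A * (2 * r) ^ degree p" if "norm z = 2 * r" for z
        using A[of z] that r(1) unfolding p by simp
    qed (use r in simp)
    then have "r ^ degree p \<le> 0" using r(2,3) by (simp add: power_mult_distrib algebra_simps)
    moreover have "0 < r ^ degree p" using r by simp
    ultimately show False by linarith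
  qed
  with comp show ?thesis by (auto simp: transcendental_entire_def)
qed

section \<open>Regularity functions\<close>

text \<open>Quantifying over both constants makes this property of \<open>g\<close>, unlike
  \<^term>\<open>regularity_function m \<psi> g\<close>, stable under composition.\<close>

definition dilated_regular :: "real \<Rightarrow> (real \<Rightarrow> real) \<Rightarrow> (complex \<Rightarrow> complex) \<Rightarrow> bool" where
  "dilated_regular m \<psi> g \<longleftrightarrow> (\<forall>c>1. \<forall>C>0. \<forall>\<^sub>F r in at_top.
     (C * \<psi> (max_modulus r g)) powr m \<le> max_modulus (c * \<psi> r) g)"

lemma regularity_functionE:
  assumes "regularity_function m \<psi> f"
  obtains a where "mono_on {a..} \<psi>" and "\<forall>\<^sub>F r in at_top. r \<le> \<psi> r"
    and "\<forall>\<^sub>F r in at_top. (\<psi> (max_modulus r f)) powr m \<le> max_modulus (\<psi> r) f"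
proof -
  obtain a R where "mono_on {a..} \<psi>"
    and "\<forall>r\<ge>R. a \<le> r \<and> a \<le> max_modulus r f \<and> r \<le> \<psi> r \<and>
      (\<psi> (max_modulus r f)) powr m \<le> max_modulus (\<psi> r) f"
    using assms unfolding regularity_function_def by blast
  then show thesis
    by (intro that[of a]) (auto simp: eventually_at_top_linorder)
qed

text \<open>The domain conditions involving \<open>a\<close> hold eventually because
  \<open>r\<close> and \<open>max_modulus r g\<close> both tend to infinity.\<close>

lemma regularity_functionI:
  assumes "mono_on {a..} \<psi>" and g: "transcendental_entire g"
    and "\<forall>\<^sub>F r in at_top. r \<le> \<psi> r"
    and "\<forall>\<^sub>F r in at_top. (\<psi> (max_modulus r g)) powr m \<le> max_modulus (\<psi> r) g"
  shows "regularity_function m \<psi> g"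
proof -
  have "\<forall>\<^sub>F r in at_top. a \<le> r \<and> a \<le> max_modulus r g \<and> r \<le> \<psi> r \<and>
      (\<psi> (max_modulus r g)) powr m \<le> max_modulus (\<psi> r) g"
    using eventually_ge_at_top[of a] assms(3,4)
      filterlim_max_modulus[OF g, unfolded filterlim_at_top, rule_format, of a]
    by eventually_elim auto
  then obtain R where "\<And>r. R \<le> r \<Longrightarrow> a \<le> r \<and> a \<le> max_modulus r g \<and> r \<le> \<psi> r \<and>
      (\<psi> (max_modulus r g)) powr m \<le> max_modulus (\<psi> r) g"
    by (auto simp: eventually_at_top_linorder)
  then show ?thesis
    unfolding regularity_function_def using assms(1)
    by (intro exI[of _ a] conjI exI[of _ "max R 1"]) auto
qed

text \<open>The constant leaves the power as \<open>C powr m\<close>, and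
  \<open>max_modulus_dilate\<close> at radius \<open>\<psi> r\<close> absorbs this factor into the
  dilation by \<open>c\<close>.\<close>

lemma dilated_regular_single:
  assumes f: "transcendental_entire f" and reg: "regularity_function m \<psi> f"
  shows "dilated_regular m \<psi> f"
  unfolding dilated_regular_def
proof (intro allI impI)
  fix c C :: real assume c: "c > 1" and C: "C > 0"
  obtain a where "mono_on {a..} \<psi>" and \<psi>_ge: "\<forall>\<^sub>F r in at_top. r \<le> \<psi> r"
    and reg': "\<forall>\<^sub>F r in at_top. (\<psi> (max_modulus r f)) powr m \<le> max_modulus (\<psi> r) f"
    using reg by (rule regularity_functionE)
  have \<psi>: "filterlim \<psi> at_top at_top"
    using filterlim_at_top_mono[OF filterlim_ident \<psi>_ge] .
  show "\<forall>\<^sub>F r in at_top. (C * \<psi> (max_modulus r f)) powr m \<le> max_modulus (c * \<psi> r) f"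
    using reg' eventually_compose_filterlim[OF max_modulus_dilate[OF f c, of "C powr m"] \<psi>]
      filterlim_compose[OF \<psi> filterlim_max_modulus[OF f], unfolded filterlim_at_top, rule_format, of 0]
  proof eventually_elim
    case (elim r)
    have "(C * \<psi> (max_modulus r f)) powr m = C powr m * (\<psi> (max_modulus r f)) powr m"
      using C elim by (simp add: powr_mult)
    also have "\<dots> \<le> C powr m * max_modulus (\<psi> r) f"
      using elim by (intro mult_left_mono) auto
    finally show ?case using elim by linarith
  qed
qed

text \<open>Regularity of \<open>f\<close> is applied at radius \<open>max_modulus r h\<close>,
  regularity of \<open>h\<close> at \<open>r\<close>; the two bounds for the maximum modulus of a
  composite translate to and from \<open>f \<circ> h\<close>.\<close>

lemma dilated_regular_compose:
  assumes f: "transcendental_entire f" and h: "transcendental_entire h"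
    and m: "m > 1" and mono: "mono_on {a..} \<psi>" and \<psi>_ge: "\<forall>\<^sub>F r in at_top. r \<le> \<psi> r"
    and rf: "dilated_regular m \<psi> f" and rh: "dilated_regular m \<psi> h"
  shows "dilated_regular m \<psi> (f \<circ> h)"
  unfolding dilated_regular_def
proof (intro allI impI)
  fix c C :: real assume c: "c > 1" and C: "C > 0"
  note hf = transcendental_entire_holomorphic[OF f] and hh = transcendental_entire_holomorphic[OF h]
  let ?M = "\<lambda>r. max_modulus r h"
  define d where "d = sqrt c"
  have d: "d > 1" "c = d * d" using c by (simp_all add: d_def)
  have \<psi>: "filterlim \<psi> at_top at_top"
    using filterlim_at_top_mono[OF filterlim_ident \<psi>_ge] .
  have d\<psi>: "filterlim (\<lambda>r. d * \<psi> r) at_top at_top"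
    using d by (intro filterlim_tendsto_pos_mult_at_top[OF tendsto_const _ \<psi>]) auto
  note M = filterlim_max_modulus[OF h]
  note Mg = filterlim_max_modulus[OF transcendental_entire_compose[OF f h]]
  \<comment> \<open>The free constant of \<open>h\<close> is chosen as \<open>d\<close> to match the
    dilation that \<open>rf'\<close> leaves inside \<open>f\<close>. One factor \<open>d\<close> of
    \<open>c\<close> serves \<open>rf'\<close> and \<open>rh'\<close> together, the other goes to
    \<open>max_modulus_compose_ge\<close>.\<close>
  have rh': "\<forall>\<^sub>F r in at_top. (d * \<psi> (?M r)) powr m \<le> ?M (d * \<psi> r)"
    using rh d unfolding dilated_regular_def by auto
  have rf': "\<forall>\<^sub>F r in at_top. (C * \<psi> (max_modulus r f)) powr m \<le> max_modulus (d * \<psi> r) f"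
    using rf d C unfolding dilated_regular_def by auto
  show "\<forall>\<^sub>F r in at_top. (C * \<psi> (max_modulus r (f \<circ> h))) powr m \<le> max_modulus (c * \<psi> r) (f \<circ> h)"
    using eventually_compose_filterlim[OF max_modulus_compose_ge[OF hf h d(1)] d\<psi>] rh'
      eventually_compose_filterlim[OF rf' M]
      filterlim_compose[OF d\<psi> M, unfolded filterlim_at_top, rule_format, of 1]
      eventually_ge_at_top[of 0] Mg[unfolded filterlim_at_top, rule_format, of a]
      filterlim_compose[OF \<psi> Mg, unfolded filterlim_at_top, rule_format, of 0]
  proof eventually_elim
    case (elim r)
    have le: "max_modulus r (f \<circ> h) \<le> max_modulus (?M r) f"
      by (rule max_modulus_compose_le[OF hf hh elim(5)])
    have "\<psi> (max_modulus r (f \<circ> h)) \<le> \<psi> (max_modulus (?M r) f)"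
      using le elim(6) by (intro mono_onD[OF mono]) auto
    then have "(C * \<psi> (max_modulus r (f \<circ> h))) powr m \<le> (C * \<psi> (max_modulus (?M r) f)) powr m"
      using C m elim(7) by (intro powr_mono2 mult_left_mono) auto
    also have "\<dots> \<le> max_modulus (d * \<psi> (?M r)) f" by (rule elim(3))
    also have "\<dots> \<le> max_modulus (?M (d * \<psi> r)) f"
    proof (rule max_modulus_mono[OF hf])
      \<comment> \<open>The exponent gained from \<open>h\<close> is given away: \<open>f\<close>
        already supplies the power \<open>m\<close>, and the base is at least 1.\<close>
      have "d * \<psi> (?M r) = (d * \<psi> (?M r)) powr 1" using elim(4) by simp
      also have "\<dots> \<le> (d * \<psi> (?M r)) powr m"
        using elim(4) m by (intro powr_mono) auto
      finally show "d * \<psi> (?M r) \<le> ?M (d * \<psi> r)" using elim(2) by linarith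
    qed (use elim(4) in auto)
    also have "\<dots> \<le> max_modulus (c * \<psi> r) (f \<circ> h)"
      using elim(1) by (simp add: d mult.assoc)
    finally show ?case .
  qed
qed

text \<open>The induction starts from a one-element list, since \<open>id\<close>, the empty
  composition, is not transcendental.\<close>

lemma dilated_regular_foldr_compose:
  assumes "fs \<noteq> []" and m: "m > 1" and mono: "mono_on {a..} \<psi>"
    and \<psi>_ge: "\<forall>\<^sub>F r in at_top. r \<le> \<psi> r"
    and "\<And>f. f \<in> set fs \<Longrightarrow> transcendental_entire f \<and> dilated_regular m \<psi> f"
  shows "transcendental_entire (foldr (\<circ>) fs id) \<and> dilated_regular m \<psi> (foldr (\<circ>) fs id)"
  using assms(1,5)
proof (induction fs rule: list_nonempty_induct)
  case (cons f fs)
  moreover have "foldr (\<circ>) (f # fs) id = f \<circ> foldr (\<circ>) fs id" by (simp add: fun_eq_iff)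
  ultimately show ?case
    using transcendental_entire_compose dilated_regular_compose[OF _ _ m mono \<psi>_ge]
    by (metis list.set_intros)
qed simp

theorem theorem2p2:
  fixes k :: nat and f :: "nat \<Rightarrow> complex \<Rightarrow> complex"
    and \<psi> :: "real \<Rightarrow> real \<Rightarrow> real" and g :: "complex \<Rightarrow> complex" and c :: real
  assumes "k \<ge> 1"
    and "\<forall>j\<in>{1..k}. transcendental_entire (f j)"
    and "\<forall>j\<in>{1..k}. psi_regular (f j) \<and> (\<forall>m>1. regularity_function m (\<psi> m) (f j))"
    and "g = foldr (\<circ>) (map f [1..<Suc k]) id"
    and "c > 1"
  shows "psi_regular g \<and> (\<forall>m>1. regularity_function m (\<lambda>r. c * \<psi> m r) g)"
proof -
  have key: "transcendental_entire g \<and> regularity_function m (\<lambda>r. c * \<psi> m r) g"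
    if m: "m > 1" for m
  proof -
    have reg: "regularity_function m (\<psi> m) (f j)" if "j \<in> {1..k}" for j
      using assms(3) m that by blast
    \<comment> \<open>Monotonicity and \<open>r \<le> \<psi> m r\<close> concern
      \<open>\<psi> m\<close> alone, so reading them off from the first function provides them for
      all factors.\<close>
    obtain a where mono: "mono_on {a..} (\<psi> m)" and \<psi>_ge: "\<forall>\<^sub>F r in at_top. r \<le> \<psi> m r"
      using reg[of 1] assms(1) by (auto elim: regularity_functionE)
    have "transcendental_entire g \<and> dilated_regular m (\<psi> m) g"
      unfolding assms(4)
    proof (rule dilated_regular_foldr_compose[OF _ m mono \<psi>_ge])
      fix F assume "F \<in> set (map f [1..<Suc k])"
      then obtain j where "j \<in> set [1..<Suc k]" "F = f j"
        unfolding set_map by blast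
      then have "j \<in> {1..k}" "F = f j" by (auto simp: less_Suc_eq_le simp del: upt_Suc)
      then show "transcendental_entire F \<and> dilated_regular m (\<psi> m) F"
        using assms(2) reg dilated_regular_single by blast
    qed (use assms(1) in simp)
    then have g: "transcendental_entire g" and dil: "dilated_regular m (\<psi> m) g" by auto
    have "regularity_function m (\<lambda>r. c * \<psi> m r) g"
    proof (rule regularity_functionI[OF _ g])
      show "mono_on {a..} (\<lambda>r. c * \<psi> m r)"
        using mono assms(5) by (auto simp: mono_on_def)
      show "\<forall>\<^sub>F r in at_top. r \<le> c * \<psi> m r"
        using \<psi>_ge eventually_ge_at_top[of 0]
      proof eventually_elim
        case (elim r)
        then have "1 * r \<le> c * \<psi> m r" using assms(5) by (intro mult_mono) auto
        then show ?case by simp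
      qed
      \<comment> \<open>Both constants of \<open>dilated_regular\<close> are taken equal to
        \<open>c\<close>.\<close>
      show "\<forall>\<^sub>F r in at_top. (c * \<psi> m (max_modulus r g)) powr m \<le> max_modulus (c * \<psi> m r) g"
        using dil assms(5) by (auto simp: dilated_regular_def)
    qed
    with g show ?thesis by blast
  qed
  have "transcendental_entire g" using key[of 2] by simp
  with key show ?thesis unfolding psi_regular_def by blast
qed

end
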